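(* There exist strict intensity profiles that have no intensity-efficient allocation and at which, for some realization of the random orders $\gg_1,\gg_2$, the extended Random Priority algorithm (defined in the context) leads to a final allocation that intensity-dominates the Pareto-efficient allocation found in its interim Random Priority step.
   Context: Let $A$ be a set of $n$ items and $N=\{1,\dots,n\}$ a set of $n$ agents. The intensity relation of agent $l$ is a binary relation $\dot{\succsim}_l$ on $A\times A$ with symmetric part $\dot{\sim}_l$; its induced preference on $A$ is $a\succsim_l b \Leftrightarrow (a,b)\,\dot{\succsim}_l\,(b,a)$, with asymmetric part $\succ_l$. $\dot{\succsim}_l$ is representable by a preference intensity function if there is $s_l:A\times A\to\mathbb{R}$ such that for all $a,b,c,d,e\in A$: (i) $(a,b)\,\dot{\succsim}_l\,(c,d)\Leftrightarrow s_l(a,b)\ge s_l(c,d)$; (ii) $(a,b)\,\dot{\succsim}_l\,(b,a)\Leftrightarrow s_l(a,b)\ge s_l(e,e)\ge s_l(b,a)$; (iii) $\min\{s_l(a,b),s_l(b,c)\}\ge s_l(e,e)$ implies $s_l(a,c)\ge\max\{s_l(a,b),s_l(b,c)\}$, and a strict inequality in the hypothesis implies a strict inequality in the conclusion; (iv) (reversal) $s_l(a,b)\ge s_l(c,d)\Leftrightarrow s_l(d,c)\ge s_l(b,a)$. Strictness: $(a,b)\,\dot{\sim}_l\,(c,d)$ fails for all distinct pairs $(a,b)\neq(c,d)$ with $a\ne b$, $c\ne d$. A strict intensity profile is a tuple $(\dot{\succsim}_1,\dots,\dot{\succsim}_n)$ of representable relations satisfying Strictness; each induced preference is then a strict linear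 order. From now on $s_l$ denotes the canonical representation of $\dot{\succsim}_l$, i.e. the one with range $\{-k,\dots,-1,0,1,\dots,k\}$, $k=\binom n2$; it satisfies $s_l(a,a)=0$, $s_l(a,b)=-s_l(b,a)$ and $s_l(a,b)>0\Leftrightarrow a\succ_l b$. An allocation is a bijection $x:N\to A$, $i\mapsto x_i$. It is Pareto-efficient if no allocation $y$ satisfies $y_i\succsim_i x_i$ for all $i$ and $y_i\succ_i x_i$ for some $i$. Allocation $x$ intensity-dominates allocation $y$ if for every pair of distinct agents $(i,j)$ such that $(x_i,x_j)=(y_j,y_i)=(a,b)$ it holds that $s_i(a,b)\ge s_j(a,b)$, with strict inequality for some such pair. An allocation is intensity-efficient if it is Pareto-efficient and not intensity-dominated by another Pareto-efficient allocation. The algorithm. Input: a strict intensity profile, given by $(s_1,\dots,s_n)$. Step 1: draw a linear order $\gg_1$ over $N$ uniformly at random. Step 2 (Random Priority): going through the agents in the order $\gg_1$, assign each agent their most preferred item among those not yet assigned; the result is a Pareto-efficient allocation $x$. Step 3: draw a linear order $\gg_2$ over $N$ uniformly at random. Step 4: let $i$ be the $\gg_2$-highest remaining agent. Look for the $\gg_2$-lowest remaining agent $j\ne i$ such that $s_i(x_j,x_i)>s_j(x_j,x_i)$. If such $j$ exists, swap the items $x_i$ and $x_j$ between $i$ and $j$, and remove agents $i,j$ and items $x_i,x_j$. If no such $j$ exists, remove agent $i$ and item $x_i$ (so $i$ keeps $x_i$). Repeat Step 4 until no agents remain. *)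

theory Defs
  imports Complex_Main
begin

text \<open>
  Agents are the numbers in \<open>{1..n}\<close>. The intensity relation of an agent is a set of pairs of pairs:
  \<open>((a, b), (c, d)) \<in> R\<close> says that the intensity of \<open>a\<close> over \<open>b\<close> is at least that of \<open>c\<close> over \<open>d\<close>.
\<close>

type_synonym 'a intensity_rel = "(('a \<times> 'a) \<times> ('a \<times> 'a)) set"

definition weakly_prefers :: "'a intensity_rel \<Rightarrow> 'a \<Rightarrow> 'a \<Rightarrow> bool" where
  "weakly_prefers R a b \<longleftrightarrow> ((a, b), (b, a)) \<in> R"

definition strictly_prefers :: "'a intensity_rel \<Rightarrow> 'a \<Rightarrow> 'a \<Rightarrow> bool" where
  "strictly_prefers R a b \<longleftrightarrow> weakly_prefers R a b \<and> \<not> weakly_prefers R b a"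

text \<open>
  Only the values of \<open>s\<close> on \<open>A \<times> A\<close> matter. In the third condition, the strict hypothesis is that
  the minimum itself, hence each of the two intensities, exceeds \<open>s e e\<close>.
\<close>

definition represents :: "'a set \<Rightarrow> 'a intensity_rel \<Rightarrow> ('a \<Rightarrow> 'a \<Rightarrow> real) \<Rightarrow> bool" where
  "represents A R s \<longleftrightarrow>
     (\<forall>a\<in>A. \<forall>b\<in>A. \<forall>c\<in>A. \<forall>d\<in>A. ((a, b), (c, d)) \<in> R \<longleftrightarrow> s a b \<ge> s c d) \<and>
     (\<forall>a\<in>A. \<forall>b\<in>A. \<forall>e\<in>A. ((a, b), (b, a)) \<in> R \<longleftrightarrow> s a b \<ge> s e e \<and> s e e \<ge> s b a) \<and>
     (\<forall>a\<in>A. \<forall>b\<in>A. \<forall>c\<in>A. \<forall>e\<in>A.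
        (min (s a b) (s b c) \<ge> s e e \<longrightarrow> s a c \<ge> max (s a b) (s b c)) \<and>
        (min (s a b) (s b c) > s e e \<longrightarrow> s a c > max (s a b) (s b c))) \<and>
     (\<forall>a\<in>A. \<forall>b\<in>A. \<forall>c\<in>A. \<forall>d\<in>A. s a b \<ge> s c d \<longleftrightarrow> s d c \<ge> s b a)"

definition representable :: "'a set \<Rightarrow> 'a intensity_rel \<Rightarrow> bool" where
  "representable A R \<longleftrightarrow> (\<exists>s. represents A R s)"

definition strictness :: "'a set \<Rightarrow> 'a intensity_rel \<Rightarrow> bool" where
  "strictness A R \<longleftrightarrow>
     (\<forall>a\<in>A. \<forall>b\<in>A. \<forall>c\<in>A. \<forall>d\<in>A. (a, b) \<noteq> (c, d) \<and> a \<noteq> b \<and> c \<noteq> d \<longrightarrow>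
        \<not> (((a, b), (c, d)) \<in> R \<and> ((c, d), (a, b)) \<in> R))"

definition strict_intensity_profile :: "nat \<Rightarrow> 'a set \<Rightarrow> (nat \<Rightarrow> 'a intensity_rel) \<Rightarrow> bool" where
  "strict_intensity_profile n A R \<longleftrightarrow>
     finite A \<and> card A = n \<and>
     (\<forall>l\<in>{1..n}. R l \<subseteq> (A \<times> A) \<times> (A \<times> A) \<and> representable A (R l) \<and> strictness A (R l))"

definition canonical_representation :: "'a set \<Rightarrow> 'a intensity_rel \<Rightarrow> ('a \<Rightarrow> 'a \<Rightarrow> real) \<Rightarrow> bool" where
  "canonical_representation A R s \<longleftrightarrow>
     represents A R s \<and>
     (\<lambda>(a, b). s a b) ` (A \<times> A) = real_of_int ` {- int (card A choose 2)..int (card A choose 2)}"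

definition allocation :: "nat \<Rightarrow> 'a set \<Rightarrow> (nat \<Rightarrow> 'a) \<Rightarrow> bool" where
  "allocation n A x \<longleftrightarrow> bij_betw x {1..n} A"

definition pareto_efficient ::
  "nat \<Rightarrow> 'a set \<Rightarrow> (nat \<Rightarrow> 'a intensity_rel) \<Rightarrow> (nat \<Rightarrow> 'a) \<Rightarrow> bool" where
  "pareto_efficient n A R x \<longleftrightarrow>
     allocation n A x \<and>
     \<not> (\<exists>y. allocation n A y \<and>
            (\<forall>i\<in>{1..n}. weakly_prefers (R i) (y i) (x i)) \<and>
            (\<exists>i\<in>{1..n}. strictly_prefers (R i) (y i) (x i)))"

definition intensity_dominates ::
  "nat \<Rightarrow> 'a set \<Rightarrow> (nat \<Rightarrow> 'a \<Rightarrow> 'a \<Rightarrow> real) \<Rightarrow> (nat \<Rightarrow> 'a) \<Rightarrow> (nat \<Rightarrow> 'a) \<Rightarrow> bool" where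
  "intensity_dominates n A s x y \<longleftrightarrow>
     allocation n A x \<and> allocation n A y \<and>
     (\<forall>i\<in>{1..n}. \<forall>j\<in>{1..n}. i \<noteq> j \<and> x i = y j \<and> x j = y i \<longrightarrow> s i (x i) (x j) \<ge> s j (x i) (x j)) \<and>
     (\<exists>i\<in>{1..n}. \<exists>j\<in>{1..n}. i \<noteq> j \<and> x i = y j \<and> x j = y i \<and> s i (x i) (x j) > s j (x i) (x j))"

text \<open>
  Allocations are functions on all of \<^typ>\<open>nat\<close>; two of them are different if they differ on some agent.
\<close>

definition intensity_efficient ::
  "nat \<Rightarrow> 'a set \<Rightarrow> (nat \<Rightarrow> 'a intensity_rel) \<Rightarrow> (nat \<Rightarrow> 'a \<Rightarrow> 'a \<Rightarrow> real) \<Rightarrow> (nat \<Rightarrow> 'a) \<Rightarrow> bool" where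
  "intensity_efficient n A R s x \<longleftrightarrow>
     pareto_efficient n A R x \<and>
     \<not> (\<exists>y. pareto_efficient n A R y \<and> (\<exists>i\<in>{1..n}. y i \<noteq> x i) \<and> intensity_dominates n A s y x)"

text \<open>
  A linear order over the agents is given as the list of all agents, highest agent first.
\<close>

definition agent_order :: "nat \<Rightarrow> nat list \<Rightarrow> bool" where
  "agent_order n p \<longleftrightarrow> distinct p \<and> set p = {1..n}"

definition most_preferred :: "'a intensity_rel \<Rightarrow> 'a set \<Rightarrow> 'a" where
  "most_preferred R B = (THE a. a \<in> B \<and> (\<forall>b\<in>B. weakly_prefers R a b))"

fun random_priority_aux ::
  "(nat \<Rightarrow> 'a intensity_rel) \<Rightarrow> nat list \<Rightarrow> 'a set \<Rightarrow> (nat \<Rightarrow> 'a) \<Rightarrow> nat \<Rightarrow> 'a" where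
  "random_priority_aux R [] B x = x"
| "random_priority_aux R (i # p) B x =
     (let a = most_preferred (R i) B in random_priority_aux R p (B - {a}) (x(i := a)))"

definition random_priority :: "(nat \<Rightarrow> 'a intensity_rel) \<Rightarrow> 'a set \<Rightarrow> nat list \<Rightarrow> nat \<Rightarrow> 'a" where
  "random_priority R A p = random_priority_aux R p A (\<lambda>_. undefined)"

text \<open>
  The list argument holds the remaining agents, highest first, so that the lowest partner \<open>j\<close>
  is the first one found in the reversed list. Only items of remaining agents are ever compared.
\<close>

function swap_phase :: "(nat \<Rightarrow> 'a \<Rightarrow> 'a \<Rightarrow> real) \<Rightarrow> nat list \<Rightarrow> (nat \<Rightarrow> 'a) \<Rightarrow> nat \<Rightarrow> 'a" where
  "swap_phase s [] x = x"
| "swap_phase s (i # q) x =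
     (case find (\<lambda>j. s i (x j) (x i) > s j (x j) (x i)) (rev q) of
        None \<Rightarrow> swap_phase s q x
      | Some j \<Rightarrow> swap_phase s (removeAll j q) (x(i := x j, j := x i)))"
  by pat_completeness auto
termination
  by (relation "measure (\<lambda>(s, q, x). length q)") (auto simp: less_Suc_eq_le)

definition extended_random_priority ::
  "(nat \<Rightarrow> 'a intensity_rel) \<Rightarrow> (nat \<Rightarrow> 'a \<Rightarrow> 'a \<Rightarrow> real) \<Rightarrow> 'a set \<Rightarrow> nat list \<Rightarrow> nat list \<Rightarrow> nat \<Rightarrow> 'a" where
  "extended_random_priority R s A p q = swap_phase s q (random_priority R A p)"

end

theory Submission
  imports Defs "HOL-Combinatorics.Transposition"
begin

text \<open>
  Let all agents rank four items \<open>0, 1, 2, 3\<close> from best to worst, so that every allocation is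
  Pareto-efficient. Three agents share one intensity relation, and the relation of the fourth one is
  chosen such that, whichever item the fourth agent holds, a swap with one of the others
  intensity-dominates: the item of the fourth agent moves around the cycle \<open>0, 2, 3, 1, 0\<close>.
  Hence nothing is intensity-efficient, and a single swap made by the algorithm already dominates
  its Random Priority allocation.
\<close>

section \<open>Intensity relations given by gaps between ranked items\<close>

text \<open>Smaller numbers stand for better items, so only the gaps from a better to a worse item
  are free data. The values on reversed pairs and on the diagonal are forced by the antisymmetry of
  a canonical representation.\<close>

definition signed_gap :: "(nat \<Rightarrow> nat \<Rightarrow> int) \<Rightarrow> nat \<Rightarrow> nat \<Rightarrow> real" where
  "signed_gap t a b =
     (if a < b then real_of_int (t a b) else if b < a then - real_of_int (t b a) else 0)"

definition relation_by :: "'a set \<Rightarrow> ('a \<Rightarrow> 'a \<Rightarrow> real) \<Rightarrow> 'a intensity_rel" where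
  "relation_by A s = {((a, b), (c, d)). {a, b, c, d} \<subseteq> A \<and> s c d \<le> s a b}"

definition ranked_pairs :: "nat set \<Rightarrow> (nat \<times> nat) set" where
  "ranked_pairs A = {(a, b). a \<in> A \<and> b \<in> A \<and> a < b}"

text \<open>The bijection serves twice: injectivity gives Strictness, surjectivity gives the
  canonical range. The inequality is what the transitivity condition on representations demands of
  three items in descending preference.\<close>

definition gap_function :: "nat set \<Rightarrow> (nat \<Rightarrow> nat \<Rightarrow> int) \<Rightarrow> bool" where
  "gap_function A t \<longleftrightarrow>
     bij_betw (\<lambda>(a, b). t a b) (ranked_pairs A) {1..int (card A choose 2)} \<and>
     (\<forall>a\<in>A. \<forall>b\<in>A. \<forall>c\<in>A. a < b \<and> b < c \<longrightarrow> max (t a b) (t b c) < t a c)"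

lemma signed_gap_antisym: "signed_gap t a b = - signed_gap t b a"
  by (simp add: signed_gap_def)

lemma signed_gap_refl [simp]: "signed_gap t a a = 0"
  by (simp add: signed_gap_def)

lemma relation_by_iff:
  assumes "a \<in> A" "b \<in> A" "c \<in> A" "d \<in> A"
  shows "((a, b), (c, d)) \<in> relation_by A s \<longleftrightarrow> s c d \<le> s a b"
  using assms by (simp add: relation_by_def)

lemma gap_pos:
  assumes "gap_function A t" "a \<in> A" "b \<in> A" "a < b"
  shows "0 < t a b"
proof -
  have "(a, b) \<in> ranked_pairs A"
    using assms by (simp add: ranked_pairs_def)
  then have "t a b \<in> {1..int (card A choose 2)}"
    using assms(1) bij_betwE unfolding gap_function_def by fastforce
  then show ?thesis by simp
qed

lemma signed_gap_nonneg_iff: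
  assumes "gap_function A t" "a \<in> A" "b \<in> A"
  shows "0 \<le> signed_gap t a b \<longleftrightarrow> a \<le> b"
  using gap_pos[OF assms] gap_pos[OF assms(1,3,2)] by (auto simp: signed_gap_def)

lemma signed_gap_pos_iff:
  assumes "gap_function A t" "a \<in> A" "b \<in> A"
  shows "0 < signed_gap t a b \<longleftrightarrow> a < b"
  using gap_pos[OF assms] gap_pos[OF assms(1,3,2)] by (auto simp: signed_gap_def)

lemma signed_gap_strict_trans:
  assumes "gap_function A t" "a \<in> A" "b \<in> A" "c \<in> A" "a < b" "b < c"
  shows "max (signed_gap t a b) (signed_gap t b c) < signed_gap t a c"
proof -
  have "max (t a b) (t b c) < t a c"
    using assms unfolding gap_function_def by blast
  then show ?thesis
    using assms(5,6) by (simp add: signed_gap_def)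
qed

text \<open>If two neighbouring items coincide, one gap is 0 and the other is the total gap, so only
  the strict case needs the inequality in \<open>gap_function\<close>.\<close>

lemma signed_gap_trans:
  assumes "gap_function A t" "a \<in> A" "b \<in> A" "c \<in> A" "a \<le> b" "b \<le> c"
  shows "max (signed_gap t a b) (signed_gap t b c) \<le> signed_gap t a c"
proof (cases "a = b \<or> b = c")
  case True
  then show ?thesis
    using assms signed_gap_nonneg_iff[OF assms(1)] by auto
next
  case False
  then show ?thesis
    using signed_gap_strict_trans[OF assms(1-4)] assms(5,6) by linarith
qed

lemma signed_gap_represents:
  assumes "gap_function A t"
  shows "represents A (relation_by A (signed_gap t)) (signed_gap t)"
proof -
  let ?s = "signed_gap t"
  \<comment> \<open>Since \<open>?s e e\<close> is 0 and \<open>?s\<close> is antisymmetric, both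
    sides just say that \<open>?s a b\<close> is nonnegative. Antisymmetry also gives the reversal
    condition below.\<close>
  have "?s a b \<ge> ?s e e \<and> ?s e e \<ge> ?s b a \<longleftrightarrow> ?s b a \<le> ?s a b" for a b e
    using signed_gap_antisym[of t a b] by auto
  moreover have "?s c d \<le> ?s a b \<longleftrightarrow> ?s b a \<le> ?s d c" for a b c d
    using signed_gap_antisym[of t a b] signed_gap_antisym[of t c d] by auto
  moreover have "?s a c \<ge> max (?s a b) (?s b c)"
    if "a \<in> A" "b \<in> A" "c \<in> A" "min (?s a b) (?s b c) \<ge> ?s e e" for a b c e
    using that signed_gap_trans[OF assms, of a b c] signed_gap_nonneg_iff[OF assms] by simp
  moreover have "?s a c > max (?s a b) (?s b c)"
    if "a \<in> A" "b \<in> A" "c \<in> A" "min (?s a b) (?s b c) > ?s e e" for a b c e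
    using that signed_gap_strict_trans[OF assms, of a b c] signed_gap_pos_iff[OF assms] by simp
  ultimately show ?thesis
    unfolding represents_def
    by (intro conjI ballI impI) (simp_all only: relation_by_iff, metis+)
qed

text \<open>Equal values have equal signs, so both pairs point the same way along the ranking. After
  reversing both if necessary, injectivity on \<open>ranked_pairs\<close> applies.\<close>

lemma signed_gap_strictness:
  assumes "gap_function A t"
  shows "strictness A (relation_by A (signed_gap t))"
proof -
  have inj: "(a, b) = (c, d)"
    if "a \<in> A" "b \<in> A" "c \<in> A" "d \<in> A" "a < b" "c < d"
      and "signed_gap t a b = signed_gap t c d" for a b c d
  proof -
    have "inj_on (\<lambda>(a, b). t a b) (ranked_pairs A)"
      using assms unfolding gap_function_def bij_betw_def by blast
    moreover have "t a b = t c d"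
      using that by (simp add: signed_gap_def)
    ultimately show ?thesis
      using that by (auto simp: ranked_pairs_def dest: inj_onD[where x = "(a, b)" and y = "(c, d)"])
  qed
  have "(a, b) = (c, d)"
    if mem: "a \<in> A" "b \<in> A" "c \<in> A" "d \<in> A" and ne: "a \<noteq> b" "c \<noteq> d"
      and eq: "signed_gap t a b = signed_gap t c d" for a b c d
  proof (cases "a < b")
    case True
    then have "c < d"
      using mem eq signed_gap_pos_iff[OF assms] by metis
    then show ?thesis
      using True inj mem eq by blast
  next
    case False
    then have "b < a" "d < c"
      using mem ne eq signed_gap_nonneg_iff[OF assms] by (metis linorder_neqE_nat leD less_imp_le)+
    moreover have "signed_gap t b a = signed_gap t d c"
      using eq signed_gap_antisym by metis
    ultimately show ?thesis
      using inj mem by blast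
  qed
  then show ?thesis
    unfolding strictness_def by (metis relation_by_iff order_antisym)
qed

text \<open>Ranked pairs supply the positive values, their reversals the negative ones, and the
  diagonal supplies 0, which is where \<open>A\<close> has to be nonempty.\<close>

lemma signed_gap_canonical:
  assumes "gap_function A t" "A \<noteq> {}"
  shows "canonical_representation A (relation_by A (signed_gap t)) (signed_gap t)"
proof -
  let ?k = "int (card A choose 2)"
  have im: "(\<lambda>(a, b). t a b) ` ranked_pairs A = {1..?k}"
    using assms(1) unfolding gap_function_def bij_betw_def by blast
  have up: "t a b \<in> {1..?k}" if "a \<in> A" "b \<in> A" "a < b" for a b
  proof -
    have "(a, b) \<in> ranked_pairs A"
      using that by (simp add: ranked_pairs_def)
    then show ?thesis
      using im by (metis (mono_tags, lifting) case_prod_conv imageI)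
  qed
  have "signed_gap t a b \<in> real_of_int ` {- ?k..?k}" if "a \<in> A" "b \<in> A" for a b
  proof (cases a b rule: linorder_cases)
    case less
    then have "signed_gap t a b = real_of_int (t a b)" "t a b \<in> {- ?k..?k}"
      using up that by (fastforce simp: signed_gap_def)+
    then show ?thesis by blast
  next
    case equal
    then show ?thesis by force
  next
    case greater
    then have "signed_gap t a b = real_of_int (- t b a)" "- t b a \<in> {- ?k..?k}"
      using up that by (fastforce simp: signed_gap_def)+
    then show ?thesis by blast
  qed
  moreover have "\<exists>a\<in>A. \<exists>b\<in>A. signed_gap t a b = real_of_int m" if "m \<in> {- ?k..?k}" for m
  proof (cases m "0 :: int" rule: linorder_cases)
    case equal
    then show ?thesis using assms(2) by force
  next
    case less
    then have "- m \<in> {1..?k}" using that by simp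
    then obtain a b where "(a, b) \<in> ranked_pairs A" "t a b = - m"
      using im by (metis (no_types, lifting) imageE case_prod_conv surj_pair)
    then have "signed_gap t b a = real_of_int m" "a \<in> A" "b \<in> A"
      by (auto simp: signed_gap_def ranked_pairs_def)
    then show ?thesis by blast
  next
    case greater
    then have "m \<in> {1..?k}" using that by simp
    then obtain a b where "(a, b) \<in> ranked_pairs A" "t a b = m"
      using im by (metis (no_types, lifting) imageE case_prod_conv surj_pair)
    then have "signed_gap t a b = real_of_int m" "a \<in> A" "b \<in> A"
      by (auto simp: signed_gap_def ranked_pairs_def)
    then show ?thesis by blast
  qed
  ultimately have "(\<lambda>(a, b). signed_gap t a b) ` (A \<times> A) = real_of_int ` {- ?k..?k}"
    by (intro equalityI image_subsetI) (simp_all only: split_paired_all mem_Sigma_iff case_prod_conv,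
      force)
  then show ?thesis
    using signed_gap_represents[OF assms(1)] unfolding canonical_representation_def by blast
qed

lemma strict_intensity_profile_gaps:
  assumes "finite A" "card A = n" "\<And>l. l \<in> {1..n} \<Longrightarrow> gap_function A (t l)"
  shows "strict_intensity_profile n A (\<lambda>l. relation_by A (signed_gap (t l)))"
proof -
  have "relation_by A s \<subseteq> (A \<times> A) \<times> (A \<times> A)" for s :: "nat \<Rightarrow> nat \<Rightarrow> real"
    by (auto simp: relation_by_def)
  then show ?thesis
    unfolding strict_intensity_profile_def representable_def
    using assms signed_gap_represents signed_gap_strictness by blast
qed

lemma weakly_prefers_gap_iff:
  assumes "gap_function A t" "a \<in> A" "b \<in> A"
  shows "weakly_prefers (relation_by A (signed_gap t)) a b \<longleftrightarrow> a \<le> b"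
  using assms signed_gap_nonneg_iff[OF assms] signed_gap_antisym[of t a b]
  by (auto simp: weakly_prefers_def relation_by_iff)

section \<open>Common ordinal preferences\<close>

text \<open>Under a common ranking an improvement of one agent has to be paid for by another agent, since
  the sum of all items in \<open>A\<close> is the same for every allocation.\<close>

lemma pareto_efficient_common_ranking:
  fixes x :: "nat \<Rightarrow> nat"
  assumes x: "allocation n A x"
    and pref: "\<And>l a b. l \<in> {1..n} \<Longrightarrow> a \<in> A \<Longrightarrow> b \<in> A \<Longrightarrow> weakly_prefers (R l) a b \<longleftrightarrow> a \<le> b"
  shows "pareto_efficient n A R x"
proof -
  have False
    if y: "allocation n A y" and weak: "\<forall>i\<in>{1..n}. weakly_prefers (R i) (y i) (x i)"
      and i: "i \<in> {1..n}" "strictly_prefers (R i) (y i) (x i)" for y i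
  proof -
    have mem: "x l \<in> A" "y l \<in> A" if "l \<in> {1..n}" for l
      using x y that unfolding allocation_def by (auto dest: bij_betwE)
    have "\<forall>l\<in>{1..n}. y l \<le> x l"
      using weak mem pref by blast
    moreover have "y i < x i"
      using i mem pref unfolding strictly_prefers_def by (meson not_le)
    ultimately have "sum y {1..n} < sum x {1..n}"
      using i(1) by (intro sum_strict_mono_ex1) auto
    moreover have "sum y {1..n} = sum x {1..n}"
      using x y sum.reindex_bij_betw[of x "{1..n}" A id] sum.reindex_bij_betw[of y "{1..n}" A id]
      by (simp add: allocation_def)
    ultimately show False by simp
  qed
  then show ?thesis
    using x unfolding pareto_efficient_def by blast
qed

lemma most_preferred_eq_Min:
  fixes B :: "nat set"
  assumes "finite B" "B \<noteq> {}"
    and "\<And>a b. a \<in> B \<Longrightarrow> b \<in> B \<Longrightarrow> weakly_prefers R a b \<longleftrightarrow> a \<le> b"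
  shows "most_preferred R B = Min B"
  unfolding most_preferred_def
proof (rule the_equality)
  show "Min B \<in> B \<and> (\<forall>b\<in>B. weakly_prefers R (Min B) b)"
    using assms by simp
next
  fix a assume "a \<in> B \<and> (\<forall>b\<in>B. weakly_prefers R a b)"
  then show "a = Min B"
    using assms by (metis Min_eqI)
qed

section \<open>Swaps\<close>

lemma allocation_swap:
  assumes "allocation n A x" "i \<in> {1..n}" "j \<in> {1..n}"
  shows "allocation n A (x(i := x j, j := x i))"
proof -
  have "bij_betw (x \<circ> Transposition.transpose i j) {1..n} A"
    using assms unfolding allocation_def by (intro bij_betw_trans[of _ _ "{1..n}"])
      (auto simp: bij_betw_transpose_iff)
  moreover have "x \<circ> Transposition.transpose i j = x(i := x j, j := x i)"
    by (auto simp: fun_eq_iff transpose_def)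
  ultimately show ?thesis by (simp add: allocation_def)
qed

text \<open>Only the two swapping agents are ever compared, and by antisymmetry the comparison for
  \<open>(j, i)\<close> is the same inequality as the one for \<open>(i, j)\<close>.\<close>

lemma swap_intensity_dominates:
  assumes x: "allocation n A x" and ij: "i \<in> {1..n}" "j \<in> {1..n}" "i \<noteq> j"
    and gt: "s i (x j) (x i) > s j (x j) (x i)"
    and antisym: "\<And>l a b. s l a b = - s l b a"
  shows "intensity_dominates n A s (x(i := x j, j := x i)) x"
proof -
  let ?y = "x(i := x j, j := x i)"
  have inj: "x k \<noteq> x l" if "k \<in> {1..n}" "l \<in> {1..n}" "k \<noteq> l" for k l
    using x that unfolding allocation_def bij_betw_def inj_on_def by blast
  have "s k (?y k) (?y l) \<ge> s l (?y k) (?y l)"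
    if kl: "k \<in> {1..n}" "l \<in> {1..n}" "k \<noteq> l" "?y k = x l" "?y l = x k" for k l
  proof -
    \<comment> \<open>An agent outside the swap keeps its item, which no other agent held before
      since \<open>x\<close> is injective.\<close>
    have "k = i \<and> l = j \<or> k = j \<and> l = i"
      using inj kl ij by (metis fun_upd_other fun_upd_same)
    then show ?thesis
      using gt ij antisym[of i "x i" "x j"] antisym[of j "x i" "x j"] by auto
  qed
  moreover have "\<exists>k\<in>{1..n}. \<exists>l\<in>{1..n}. k \<noteq> l \<and> ?y k = x l \<and> ?y l = x k \<and>
      s k (?y k) (?y l) > s l (?y k) (?y l)"
    using ij gt by (intro bexI[of _ i] bexI[of _ j]) auto
  ultimately show ?thesis
    unfolding intensity_dominates_def using x allocation_swap[OF x ij(1,2)] by blast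
qed

section \<open>The profile\<close>

text \<open>Only entries above the diagonal are read; the zeros are padding. The pair
  \<open>(0, 3)\<close> has value 6 in both tables, as the inequality in \<open>gap_function\<close>
  makes it the largest gap, so no dominating swap can use it. The tables are chosen to differ along
  the cycle 0, 2, 3, 1, 0, which avoids this pair.\<close>

definition majority_gap :: "nat \<Rightarrow> nat \<Rightarrow> int" where
  "majority_gap a b = [[0, 1, 5, 6], [0, 0, 2, 4], [0, 0, 0, 3]] ! a ! b"

definition minority_gap :: "nat \<Rightarrow> nat \<Rightarrow> int" where
  "minority_gap a b = [[0, 3, 4, 6], [0, 0, 1, 5], [0, 0, 0, 2]] ! a ! b"

definition profile_gap :: "nat \<Rightarrow> nat \<Rightarrow> nat \<Rightarrow> int" where
  "profile_gap l = (if l = 4 then minority_gap else majority_gap)"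

lemma ranked_pairs_four:
  "ranked_pairs {0, 1, 2, 3} = {(0, 1), (0, 2), (0, 3), (1, 2), (1, 3), (2, 3)}"
  by (auto simp: ranked_pairs_def)

lemma one_to_six: "{1..6} = {1, 2, 3, 4, 5, 6 :: int}"
  by auto

lemma gap_function_profile_gap: "gap_function {0, 1, 2, 3} (profile_gap l)"
proof -
  have "card {0, 1, 2, 3 :: nat} choose 2 = 6"
    by (simp add: choose_two)
  then show ?thesis
    unfolding gap_function_def ranked_pairs_four bij_betw_def
    by (auto simp: profile_gap_def minority_gap_def majority_gap_def one_to_six)
qed

text \<open>The item that the minority agent obtains in the dominating swap, as a function of the one held.\<close>

definition next_item :: "nat \<Rightarrow> nat" where
  "next_item a = [2, 0, 3, 1] ! a"

text \<open>Moving from 0 to 2 or from 2 to 3 is a loss, but a smaller one for agent 4 (4 against 5,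
  2 against 3). Moving from 3 to 1 or from 1 to 0 is a gain, and a larger one for agent 4 (5 against
  4, 3 against 1).\<close>

lemma next_item_gap:
  assumes "a \<in> {0, 1, 2, 3}" "l \<noteq> 4"
  shows "signed_gap (profile_gap 4) (next_item a) a > signed_gap (profile_gap l) (next_item a) a"
  using assms
  by (auto simp: next_item_def signed_gap_def profile_gap_def minority_gap_def majority_gap_def)

theorem corollary2:
  shows "\<exists>(n::nat) (A::nat set) (R::nat \<Rightarrow> nat intensity_rel) (s::nat \<Rightarrow> nat \<Rightarrow> nat \<Rightarrow> real).
    strict_intensity_profile n A R \<and>
    (\<forall>l\<in>{1..n}. canonical_representation A (R l) (s l)) \<and>
    \<not> (\<exists>x. intensity_efficient n A R s x) \<and>
    (\<exists>p q. agent_order n p \<and> agent_order n q \<and>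
       pareto_efficient n A R (random_priority R A p) \<and>
       intensity_dominates n A s (extended_random_priority R s A p q) (random_priority R A p))"
proof -
  define A :: "nat set" where "A = {0, 1, 2, 3}"
  define s where "s l = signed_gap (profile_gap l)" for l
  define R where "R l = relation_by A (s l)" for l
  have gap: "gap_function A (profile_gap l)" for l
    unfolding A_def by (rule gap_function_profile_gap)
  have pref: "weakly_prefers (R l) a b \<longleftrightarrow> a \<le> b" if "a \<in> A" "b \<in> A" for l a b
    unfolding R_def s_def using weakly_prefers_gap_iff[OF gap that] .
  have efficient: "pareto_efficient 4 A R x" if "allocation 4 A x" for x
    using that pref by (rule pareto_efficient_common_ranking)
  have antisym: "s l a b = - s l b a" for l a b
    unfolding s_def by (rule signed_gap_antisym)

  have profile: "strict_intensity_profile 4 A R"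
    unfolding R_def s_def using gap
    by (intro strict_intensity_profile_gaps) (auto simp: A_def)
  have canonical: "\<forall>l\<in>{1..4}. canonical_representation A (R l) (s l)"
    unfolding R_def s_def using gap by (auto intro!: signed_gap_canonical simp: A_def)

  have none: "\<not> (\<exists>x. intensity_efficient 4 A R s x)"
  proof
    assume "\<exists>x. intensity_efficient 4 A R s x"
    then obtain x where eff: "intensity_efficient 4 A R s x" ..
    then have x: "allocation 4 A x"
      unfolding intensity_efficient_def pareto_efficient_def by blast
    then have im: "x ` {1..4} = A"
      unfolding allocation_def bij_betw_def by blast
    moreover have "x 4 \<in> x ` {1..4}"
      by (rule imageI) simp
    ultimately have x4: "x 4 \<in> {0, 1, 2, 3}"
      unfolding A_def by (simp only:)
    then have "next_item (x 4) \<in> x ` {1..4}"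
      unfolding im A_def by (auto simp: next_item_def)
    then obtain j where j: "j \<in> {1..4}" "x j = next_item (x 4)"
      by (metis imageE)
    \<comment> \<open>\<open>next_item\<close> has no fixed point on the four items, so the holder
      \<open>j\<close> of the desired item is a majority agent.\<close>
    then have ne: "x j \<noteq> x 4"
      using x4 by (auto simp: next_item_def)
    then have "4 \<noteq> j" by auto
    have gt: "s 4 (x j) (x 4) > s j (x j) (x 4)"
      unfolding s_def j(2) using next_item_gap x4 \<open>4 \<noteq> j\<close> by metis
    have "intensity_dominates 4 A s (x(4 := x j, j := x 4)) x"
      by (rule swap_intensity_dominates[OF x _ j(1) \<open>4 \<noteq> j\<close> gt antisym]) simp
    moreover have "\<exists>i\<in>{1..4}. (x(4 := x j, j := x 4)) i \<noteq> x i"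
      using j(1) ne by (intro bexI[of _ j]) auto
    moreover have "pareto_efficient 4 A R (x(4 := x j, j := x 4))"
      using x j(1) by (intro efficient allocation_swap) auto
    ultimately show False
      using eff unfolding intensity_efficient_def by blast
  qed

  \<comment> \<open>With a common ranking, agents take the items in their order of priority. Placing
    agent 4 last leaves it item 3, whose successor on the cycle is item 1 of agent 2.\<close>
  define r where "r = random_priority R A [1, 2, 3, 4]"
  have Min: "most_preferred (R l) B = Min B" if "B \<noteq> {}" "B \<subseteq> A" for l B
  proof (rule most_preferred_eq_Min)
    show "finite B"
      using that(2) by (rule finite_subset) (simp add: A_def)
  qed (use that pref in blast)+
  have "r = (\<lambda>_. undefined)(1 := 0, 2 := 1, 3 := 2, 4 := 3)"
    unfolding r_def random_priority_def
    by (simp add: Min Let_def A_def insert_Diff_if)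
  then have r: "r 1 = 0" "r 2 = 1" "r 3 = 2" "r 4 = 3"
    by simp_all
  have agents: "{1..4} = {1, 2, 3, 4 :: nat}"
    by auto
  have r_alloc: "allocation 4 A r"
    unfolding allocation_def bij_betw_def agents using r by (auto simp: A_def)
  have less: "s 4 (r 2) (r 4) > s 2 (r 2) (r 4)"
    unfolding s_def r using next_item_gap[of 3 2] by (simp add: next_item_def)
  \<comment> \<open>Agent 4 moves first and tries partners from the lowest up. Agent 3 fails, since
    2 does not exceed 3 on the pair \<open>(2, 3)\<close>; agent 2 succeeds, since 5 exceeds 4 on
    \<open>(1, 3)\<close>. The remaining agents 1 and 3 have identical intensities and cannot
    swap.\<close>
  have "extended_random_priority R s A [1, 2, 3, 4] [4, 1, 2, 3] = r(4 := r 2, 2 := r 4)"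
    unfolding extended_random_priority_def r_def[symmetric]
    using r by (simp add: s_def signed_gap_def profile_gap_def minority_gap_def majority_gap_def)
  moreover have "intensity_dominates 4 A s (r(4 := r 2, 2 := r 4)) r"
    by (rule swap_intensity_dominates[OF r_alloc _ _ _ less antisym]) simp_all
  ultimately have
    "intensity_dominates 4 A s (extended_random_priority R s A [1, 2, 3, 4] [4, 1, 2, 3]) r"
    by simp
  moreover have "agent_order 4 [1, 2, 3, 4]" "agent_order 4 [4, 1, 2, 3]"
    by (auto simp: agent_order_def agents)
  moreover have "pareto_efficient 4 A R r"
    using r_alloc by (rule efficient)
  ultimately have "\<exists>p q. agent_order 4 p \<and> agent_order 4 q \<and>
      pareto_efficient 4 A R (random_priority R A p) \<and>
      intensity_dominates 4 A s (extended_random_priority R s A p q) (random_priority R A p)"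
    unfolding r_def by (intro exI conjI)
  with profile canonical none show ?thesis
    by (intro exI[of _ 4] exI[of _ A] exI[of _ R] exI[of _ s] conjI)
qed

end
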